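(* Let $q\geq 2$ be an even integer, $\omega=\exp(2\pi\sqrt{-1}/q)$, let $m\geq 4$ be an integer, and let $\pi$ be a permutation of $\{0,1,\dots,m-3\}$. Let $e_0,\dots,e_{m-3},f_0,\dots,f_{m-3}\in\mathbb{Z}_q$. For $d\in\mathbb{Z}_2$ define the Boolean functions of $x_0,\dots,x_{m-3}$ $$\zeta^d=\sum_{\alpha=0}^{m-4}x_{\pi(\alpha)}x_{\pi(\alpha+1)}+d\,x_{\pi(m-3)},\qquad \eta^d=\sum_{\alpha=0}^{m-4}\bar{x}_{\pi(\alpha)}\bar{x}_{\pi(\alpha+1)}+\bar{d}\,x_{\pi(m-3)},$$ (with $\bar x=1-x$, $\bar d=1-d$), and the generalized Boolean function $g^d:\mathbb{Z}_2^m\to\mathbb{Z}_q$ $$g^d=\frac{q}{2}\Big[x_{m-2}\bar{x}_{m-1}\,\zeta^d+\bar{x}_{m-2}x_{m-1}\,\eta^d+d\,\bar{x}_{m-2}\bar{x}_{m-1}+x_{m-2}x_{m-1}\Big]+\sum_{i=0}^{m-3}e_ix_i+\sum_{i=0}^{m-3}f_i\bar{x}_i .$$ Let $\mathbf{a}=\Psi_{2^{m-2}-1}(g^0)$ and $\mathbf{b}=\Psi_{2^{m-2}-1}(g^1)$. Then $(\mathbf{a},\mathbf{b})$ is a Z-complementary pair of (even) length $2^m-2(2^{m-2}-1)=2^{m-1}+2$ with ZCZ width $2^{m-2}+2^{\pi(m-3)}+1$, i.e. $\rho_{\mathbf{a}}(\tau)+\rho_{\mathbf{b}}(\tau)=0$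 for all $1\leq\tau\leq 2^{m-2}+2^{\pi(m-3)}$.
   Context: For a function $f:\mathbb{Z}_2^m\to\mathbb{Z}_q$, $\Psi(f)$ denotes the length-$2^m$ sequence $(\omega^{f_0},\omega^{f_1},\dots,\omega^{f_{2^m-1}})$, where $f_i=f(r_{i,0},r_{i,1},\dots,r_{i,m-1})$ and $i=\sum_{j=0}^{m-1}r_{i,j}2^j$ is the binary expansion of $i$ (so $x_0$ corresponds to the least significant bit). For an integer $L\ge 0$, $\Psi_L(f)$ denotes the sequence obtained from $\Psi(f)$ by deleting its first $L$ and its last $L$ entries. For complex sequences $\mathbf{u}=(u_0,\dots,u_{N-1})$, the aperiodic autocorrelation is $\rho_{\mathbf{u}}(\tau)=\sum_{k=0}^{N-1-\tau}u_k\overline{u_{k+\tau}}$ for $0\le\tau\le N-1$ (and $0$ for $\tau\ge N$). A pair $(\mathbf{a},\mathbf{b})$ of length-$N$ sequences is a Z-complementary pair with ZCZ width $Z$ if $\rho_{\mathbf{a}}(\tau)+\rho_{\mathbf{b}}(\tau)=0$ for all $1\le\tau\le Z-1$; for $q=2$ and even $N$ this is called an even-length binary Z-complementary pair (EB-ZCP). *)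

theory Defs
  imports Complex_Main "HOL-Combinatorics.Permutations"
begin

text \<open>
  Elements of \<open>\<int>\<^sub>n\<close> are represented by their residues in \<open>{0..<n}\<close>, as integers.
  A point of \<open>\<int>\<^sub>2\<^sup>m\<close> is a function \<open>x :: nat \<Rightarrow> int\<close> of which only
  \<open>x 0, \<dots>, x (m - 1) \<in> {0, 1}\<close> matter, so the complement of \<open>x i\<close> is \<open>1 - x i\<close>.
\<close>

definition omega :: "nat \<Rightarrow> complex" where
  "omega q = exp (2 * of_real pi * \<i> / of_nat q)"

definition binary_digits :: "nat \<Rightarrow> nat \<Rightarrow> int" where
  "binary_digits i j = int (i div 2 ^ j mod 2)"

definition Psi :: "nat \<Rightarrow> nat \<Rightarrow> ((nat \<Rightarrow> int) \<Rightarrow> int) \<Rightarrow> complex list" where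
  "Psi q m f = map (\<lambda>i. omega q powi f (binary_digits i)) [0..<2 ^ m]"

definition Psi_trunc :: "nat \<Rightarrow> nat \<Rightarrow> nat \<Rightarrow> ((nat \<Rightarrow> int) \<Rightarrow> int) \<Rightarrow> complex list" where
  "Psi_trunc q m L f = take (2 ^ m - 2 * L) (drop L (Psi q m f))"

definition autocorrelation :: "complex list \<Rightarrow> nat \<Rightarrow> complex" where
  "autocorrelation u \<tau> =
    (if \<tau> < length u then \<Sum>k = 0..length u - 1 - \<tau>. u ! k * cnj (u ! (k + \<tau>)) else 0)"

definition Z_complementary_pair :: "nat \<Rightarrow> nat \<Rightarrow> complex list \<Rightarrow> complex list \<Rightarrow> bool" where
  "Z_complementary_pair N Z a b \<longleftrightarrow>
    length a = N \<and> length b = N \<and>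
    (\<forall>\<tau>\<in>{1..Z - 1}. autocorrelation a \<tau> + autocorrelation b \<tau> = 0)"

definition zeta :: "nat \<Rightarrow> (nat \<Rightarrow> nat) \<Rightarrow> int \<Rightarrow> (nat \<Rightarrow> int) \<Rightarrow> int" where
  "zeta m \<pi> d x =
    ((\<Sum>\<alpha> = 0..m - 4. x (\<pi> \<alpha>) * x (\<pi> (\<alpha> + 1))) + d * x (\<pi> (m - 3))) mod 2"

definition eta :: "nat \<Rightarrow> (nat \<Rightarrow> nat) \<Rightarrow> int \<Rightarrow> (nat \<Rightarrow> int) \<Rightarrow> int" where
  "eta m \<pi> d x =
    ((\<Sum>\<alpha> = 0..m - 4. (1 - x (\<pi> \<alpha>)) * (1 - x (\<pi> (\<alpha> + 1)))) + (1 - d) * x (\<pi> (m - 3))) mod 2"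

definition gbf ::
  "nat \<Rightarrow> nat \<Rightarrow> (nat \<Rightarrow> nat) \<Rightarrow> (nat \<Rightarrow> int) \<Rightarrow> (nat \<Rightarrow> int) \<Rightarrow> int \<Rightarrow> (nat \<Rightarrow> int) \<Rightarrow> int" where
  "gbf q m \<pi> e f d x =
    (int (q div 2) *
       (x (m - 2) * (1 - x (m - 1)) * zeta m \<pi> d x
        + (1 - x (m - 2)) * x (m - 1) * eta m \<pi> d x
        + d * (1 - x (m - 2)) * (1 - x (m - 1))
        + x (m - 2) * x (m - 1))
     + (\<Sum>i = 0..m - 3. e i * x i)
     + (\<Sum>i = 0..m - 3. f i * (1 - x i))) mod int q"

end

theory Submission
  imports Defs
begin

text \<open>
  Put \<open>M = 2 ^ (m - 2)\<close>. The truncated sequences are \<open>(c, A\<^sub>0, B\<^sub>0, c')\<close> and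
  \<open>(- c, A\<^sub>1, B\<^sub>1, c')\<close> with blocks of length \<open>M\<close>. Here \<open>(A\<^sub>0, A\<^sub>1)\<close> is the Golay pair attached
  to the path \<open>\<pi>\<close>. Since complementing all bits reverses a block, there is a unimodular \<open>K\<close> such that
  \<open>B\<^sub>0\<close> is \<open>- K\<close> times the conjugate reversal of \<open>A\<^sub>1\<close> and \<open>B\<^sub>1\<close> is \<open>K\<close> times that of \<open>A\<^sub>0\<close>; that is,
  \<open>(B\<^sub>0, B\<^sub>1)\<close> is a mate of \<open>(A\<^sub>0, A\<^sub>1)\<close>, so the products inside and across the blocks cancel.
  The products with an end entry cancel against each other for shifts \<open>\<tau> \<le> M\<close>. For larger \<open>\<tau>\<close> they
  are multiples of the entry of \<open>A\<^sub>0 + A\<^sub>1\<close> at position \<open>2 * M - \<tau>\<close>, which vanishes as long as bit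
  \<open>\<pi> (m - 3)\<close> of that position is 1.
\<close>

section \<open>Sign-reversing sums and binary digits\<close>

lemma sum_sign_reversing_involution:
  fixes t :: "'a \<Rightarrow> complex"
  assumes "\<And>k. k \<in> S \<Longrightarrow> \<phi> k \<in> S" "\<And>k. k \<in> S \<Longrightarrow> \<phi> (\<phi> k) = k" "\<And>k. k \<in> S \<Longrightarrow> t (\<phi> k) = - t k"
  shows "sum t S = 0"
proof -
  have "sum t S = (\<Sum>k\<in>S. - t k)"
    by (rule sum.reindex_bij_witness[of _ \<phi> \<phi>]) (use assms in auto)
  also have "\<dots> = - sum t S"
    by (rule sum_negf)
  finally have "2 * sum t S = 0"
    by (simp only: eq_neg_iff_add_eq_0 mult_2)
  then show ?thesis
    by simp
qed

lemma binary_digits_eq_bit: "binary_digits i j = of_bool (bit i j)"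
  by (simp add: binary_digits_def bit_iff_odd mod_2_eq_odd)

lemma binary_digits_flip_bit:
  "binary_digits (flip_bit b i) j = (if j = b then 1 - binary_digits i j else binary_digits i j)"
  by (auto simp: binary_digits_eq_bit bit_flip_bit_iff)

text \<open>The increment depends only on the old digit at \<open>b\<close>, so two numbers that
  agree there keep their difference when both are flipped.\<close>

lemma int_flip_bit: "int (flip_bit b i) = int i + (1 - 2 * binary_digits i b) * 2 ^ b"
  unfolding of_nat_flip_bit_eq
  unfolding flip_bit_eq_if if_distribR set_bit_eq unset_bit_eq
  by (simp add: binary_digits_eq_bit bit_of_nat_iff_bit)

lemma flip_bit_less_power2: "i < 2 ^ n \<Longrightarrow> b < n \<Longrightarrow> flip_bit b i < (2 :: nat) ^ n"
  unfolding take_bit_nat_eq_self_iff[symmetric] by (simp add: take_bit_flip_bit_eq)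

lemma binary_digits_block:
  assumes "k < 2 ^ n"
  shows "binary_digits (2 ^ n * t + k) j = (if j < n then binary_digits k j else binary_digits t (j - n))"
proof -
  have "bit (2 ^ n * t + k) j = bit k j" if "j < n"
  proof -
    have "take_bit n (2 ^ n * t + k) = k"
      using assms by (simp add: take_bit_eq_mod)
    then show ?thesis
      using that by (metis bit_take_bit_iff)
  qed
  moreover have "bit (2 ^ n * t + k) j = bit t (j - n)" if "\<not> j < n"
  proof -
    have "drop_bit n (2 ^ n * t + k) = t"
      using assms by (simp add: drop_bit_eq_div)
    then show ?thesis
      using that by (metis bit_drop_bit_eq comp_apply le_add_diff_inverse not_less)
  qed
  ultimately show ?thesis
    by (simp add: binary_digits_eq_bit)
qed

text \<open>Subtraction from the all-ones number causes no borrows, so reversing the positions of a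
  block complements every digit.\<close>

lemma binary_digits_complement:
  assumes "k < 2 ^ n" "j < n"
  shows "binary_digits (2 ^ n - 1 - k) j = 1 - binary_digits k j"
proof -
  have "int (2 ^ n - 1 - k) = take_bit n (Bit_Operations.not (int k))"
    using assms(1) take_bit_not_eq_mask_diff[of n "int k"] mask_eq_exp_minus_1[of n, where 'a = int]
    by (simp add: take_bit_int_eq_self of_nat_diff del: mask_eq_exp_minus_1)
  then have "bit (int (2 ^ n - 1 - k)) j \<longleftrightarrow> \<not> bit (int k) j"
    using assms(2) by (simp add: bit_simps)
  then show ?thesis
    by (simp add: binary_digits_eq_bit bit_of_nat_iff_bit)
qed

section \<open>Golay pairs attached to a path\<close>

definition path_form :: "nat \<Rightarrow> (nat \<Rightarrow> nat) \<Rightarrow> (nat \<Rightarrow> int) \<Rightarrow> int" where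
  "path_form r \<pi> x = (\<Sum>\<alpha><r. x (\<pi> \<alpha>) * x (\<pi> (Suc \<alpha>)))"

definition linear_form :: "nat \<Rightarrow> (nat \<Rightarrow> int) \<Rightarrow> (nat \<Rightarrow> int) \<Rightarrow> (nat \<Rightarrow> int) \<Rightarrow> int" where
  "linear_form r e f x = (\<Sum>i\<le>r. e i * x i + f i * (1 - x i))"

text \<open>Standard Golay sequence of the path \<open>\<pi> 0, \<dots>, \<pi> r\<close>;
  \<open>d = 0, 1\<close> give the two members of the pair. The sign is kept apart from the power of
  \<open>w\<close>, so that only the parity of the quadratic exponent matters.\<close>

definition golay_seq ::
  "complex \<Rightarrow> nat \<Rightarrow> (nat \<Rightarrow> nat) \<Rightarrow> (nat \<Rightarrow> int) \<Rightarrow> (nat \<Rightarrow> int) \<Rightarrow> int \<Rightarrow> nat \<Rightarrow> complex" where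
  "golay_seq w r \<pi> e f d k =
    (-1) powi (path_form r \<pi> (binary_digits k) + d * binary_digits k (\<pi> r))
      * w powi linear_form r e f (binary_digits k)"

lemma minus_one_powi_cong: "even (s - t) \<Longrightarrow> (-1 :: complex) powi s = (-1) powi t"
  by (simp add: power_int_minus_left)

lemma linear_form_flip_bit:
  assumes "b \<le> r"
  shows "linear_form r e f (binary_digits (flip_bit b i)) - linear_form r e f (binary_digits i)
    = (e b - f b) * (1 - 2 * binary_digits i b)"
proof -
  have "linear_form r e f (binary_digits (flip_bit b i)) - linear_form r e f (binary_digits i)
    = (\<Sum>j\<le>r. if j = b then (e b - f b) * (1 - 2 * binary_digits i b) else 0)"
    unfolding linear_form_def sum_subtractf[symmetric]
    by (intro sum.cong) (auto simp: binary_digits_flip_bit algebra_simps)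
  then show ?thesis
    using assms by simp
qed

text \<open>Flipping vertex \<open>Suc v\<close> affects only its two edges. On the edge to the
  following vertex, if there is one, the changes for \<open>x\<close> and \<open>y\<close> agree; on
  the edge from \<open>v\<close> they differ by a product of two factors, each 1 or -1.\<close>

lemma path_form_flip_bit:
  fixes i j r v :: nat and \<pi> :: "nat \<Rightarrow> nat"
  defines "x \<equiv> binary_digits i" and "y \<equiv> binary_digits j"
    and "x' \<equiv> binary_digits (flip_bit (\<pi> (Suc v)) i)"
    and "y' \<equiv> binary_digits (flip_bit (\<pi> (Suc v)) j)"
  assumes inj: "inj_on \<pi> {..r}" and v: "v < r"
    and neq: "x (\<pi> v) \<noteq> y (\<pi> v)"
    and agree: "\<And>\<alpha>. v < \<alpha> \<Longrightarrow> \<alpha> \<le> r \<Longrightarrow> x (\<pi> \<alpha>) = y (\<pi> \<alpha>)"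
  shows "odd ((path_form r \<pi> x' - path_form r \<pi> y') - (path_form r \<pi> x - path_form r \<pi> y))"
proof -
  define \<delta> where "\<delta> = 1 - 2 * x (\<pi> (Suc v))"
  have x': "x' (\<pi> \<alpha>) = x (\<pi> \<alpha>) + (if \<alpha> = Suc v then \<delta> else 0)"
    and y': "y' (\<pi> \<alpha>) = y (\<pi> \<alpha>) + (if \<alpha> = Suc v then \<delta> else 0)" if "\<alpha> \<le> r" for \<alpha>
  proof -
    have "\<pi> \<alpha> = \<pi> (Suc v) \<longleftrightarrow> \<alpha> = Suc v"
      using inj_onD[OF inj, of \<alpha> "Suc v"] that v by auto
    then show "x' (\<pi> \<alpha>) = x (\<pi> \<alpha>) + (if \<alpha> = Suc v then \<delta> else 0)"
      and "y' (\<pi> \<alpha>) = y (\<pi> \<alpha>) + (if \<alpha> = Suc v then \<delta> else 0)"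
      using agree[of "Suc v"] v
      by (auto simp: x'_def y'_def \<delta>_def binary_digits_flip_bit x_def y_def)
  qed
  have "(path_form r \<pi> x' - path_form r \<pi> y') - (path_form r \<pi> x - path_form r \<pi> y)
    = (\<Sum>\<alpha><r. if \<alpha> = v then (x (\<pi> v) - y (\<pi> v)) * \<delta> else 0)"
    unfolding path_form_def sum_subtractf[symmetric]
  proof (intro sum.cong refl)
    fix \<alpha> assume "\<alpha> \<in> {..<r}"
    then have "\<alpha> < r" by simp
    then show "x' (\<pi> \<alpha>) * x' (\<pi> (Suc \<alpha>)) - y' (\<pi> \<alpha>) * y' (\<pi> (Suc \<alpha>))
        - (x (\<pi> \<alpha>) * x (\<pi> (Suc \<alpha>)) - y (\<pi> \<alpha>) * y (\<pi> (Suc \<alpha>)))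
        = (if \<alpha> = v then (x (\<pi> v) - y (\<pi> v)) * \<delta> else 0)"
      using x'[of \<alpha>] x'[of "Suc \<alpha>"] y'[of \<alpha>] y'[of "Suc \<alpha>"] agree[of \<alpha>] agree[of "Suc \<alpha>"]
      by (auto simp: algebra_simps)
  qed
  also have "\<dots> = (x (\<pi> v) - y (\<pi> v)) * \<delta>"
    using v by simp
  also have "odd \<dots>"
    using neq by (auto simp: x_def y_def \<delta>_def binary_digits_eq_bit)
  finally show ?thesis .
qed

lemma binary_digits_eqI:
  assumes "i < 2 ^ n" "j < 2 ^ n" "\<And>b. b < n \<Longrightarrow> binary_digits i b = binary_digits j b"
  shows "i = j"
proof -
  have "bit i b \<longleftrightarrow> bit j b" if "b < n" for b
    using assms(3)[OF that] by (simp add: binary_digits_eq_bit of_bool_eq_iff)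
  then have "take_bit n i = take_bit n j"
    by (intro bit_eqI) (auto simp: bit_take_bit_iff)
  then show ?thesis
    using assms(1,2) by (simp add: take_bit_nat_eq_self)
qed

lemma cnj_powi_unit:
  assumes "norm w = 1"
  shows "cnj (w powi n) = w powi (- n)"
proof -
  have "w * cnj w = 1"
    using assms by (simp flip: complex_norm_square)
  then have "cnj w = inverse w"
    by (rule inverse_unique[symmetric])
  then show ?thesis
    by (simp add: power_int_inverse power_int_minus)
qed

lemma cnj_minus_one_powi: "cnj ((-1) powi n) = (-1) powi (- n)"
  by (simp add: power_int_minus_one_minus)

lemma minus_one_nonzero: "(-1 :: complex) \<noteq> 0"
  by simp

lemma powi_diff: "w \<noteq> 0 \<Longrightarrow> w powi (s - t) = w powi s * w powi (- t)" for w :: complex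
  using power_int_add[of w s "- t"] by simp

lemma golay_seq_mult_cnj:
  assumes "norm w = 1"
  shows "golay_seq w r \<pi> e f d i * cnj (golay_seq w r \<pi> e f d j) =
    (-1) powi (path_form r \<pi> (binary_digits i) - path_form r \<pi> (binary_digits j)
        + d * (binary_digits i (\<pi> r) - binary_digits j (\<pi> r)))
      * w powi (linear_form r e f (binary_digits i) - linear_form r e f (binary_digits j))"
proof -
  have "w \<noteq> 0"
    using assms by auto
  have exponent: "path_form r \<pi> (binary_digits i) - path_form r \<pi> (binary_digits j)
        + d * (binary_digits i (\<pi> r) - binary_digits j (\<pi> r))
      = (path_form r \<pi> (binary_digits i) + d * binary_digits i (\<pi> r))
        - (path_form r \<pi> (binary_digits j) + d * binary_digits j (\<pi> r))"
    by (simp add: algebra_simps)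
  show ?thesis
    unfolding golay_seq_def complex_cnj_mult cnj_powi_unit[OF assms] cnj_minus_one_powi exponent
      powi_diff[OF \<open>w \<noteq> 0\<close>] powi_diff[of "-1", OF minus_one_nonzero]
    by (simp only: mult_ac)
qed

theorem golay_pair:
  fixes w :: complex and e f :: "nat \<Rightarrow> int"
  assumes w: "norm w = 1" and perm: "\<pi> permutes {..r}" and "\<tau> \<ge> 1"
  defines "A \<equiv> golay_seq w r \<pi> e f"
  shows "(\<Sum>k<2 ^ Suc r - \<tau>. A 0 k * cnj (A 0 (k + \<tau>)) + A 1 k * cnj (A 1 (k + \<tau>))) = 0"
proof -
  \<comment> \<open>Flip, in both \<open>k\<close> and \<open>k + \<tau>\<close>, the bit that follows on the path the last one where they differ:
    this preserves the shift and negates the term.\<close>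
  define last_diff where
    "last_diff k = Max {\<alpha>. \<alpha> \<le> r \<and> binary_digits k (\<pi> \<alpha>) \<noteq> binary_digits (k + \<tau>) (\<pi> \<alpha>)}" for k
  define t where "t k = A 0 k * cnj (A 0 (k + \<tau>)) + A 1 k * cnj (A 1 (k + \<tau>))" for k
  define S where "S = {k \<in> {..<2 ^ Suc r - \<tau>}. binary_digits k (\<pi> r) = binary_digits (k + \<tau>) (\<pi> r)}"
  define \<phi> where "\<phi> k = flip_bit (\<pi> (Suc (last_diff k))) k" for k
  \<comment> \<open>The two products differ only in the sign from \<open>\<pi> r\<close>. The common
    factor \<open>1 + (-1) powi ...\<close> vanishes when the digits there differ, which leaves the
    indices in \<open>S\<close>.\<close>
  have t_eq: "t k = (-1) powi (path_form r \<pi> (binary_digits k) - path_form r \<pi> (binary_digits (k + \<tau>)))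
      * w powi (linear_form r e f (binary_digits k) - linear_form r e f (binary_digits (k + \<tau>)))
      * (1 + (-1) powi (binary_digits k (\<pi> r) - binary_digits (k + \<tau>) (\<pi> r)))" for k
    unfolding t_def A_def golay_seq_mult_cnj[OF w] by (simp add: power_int_add) (simp add: algebra_simps)
  have outside: "t k = 0" if "binary_digits k (\<pi> r) \<noteq> binary_digits (k + \<tau>) (\<pi> r)" for k
    using that unfolding t_eq by (auto simp: binary_digits_eq_bit)
  have inj: "inj_on \<pi> {..r}"
    using perm by (simp add: permutes_inj_on)
  have \<pi>_le: "\<pi> \<alpha> \<le> r" if "\<alpha> \<le> r" for \<alpha>
    using permutes_in_image[OF perm, of \<alpha>] that by simp
  have main: "\<phi> k \<in> S \<and> \<phi> (\<phi> k) = k \<and> t (\<phi> k) = - t k" if "k \<in> S" for k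
  proof -
    have k: "k + \<tau> < 2 ^ Suc r" and same: "binary_digits k (\<pi> r) = binary_digits (k + \<tau>) (\<pi> r)"
      using that by (auto simp: S_def)
    define D where "D = {\<alpha>. \<alpha> \<le> r \<and> binary_digits k (\<pi> \<alpha>) \<noteq> binary_digits (k + \<tau>) (\<pi> \<alpha>)}"
    define v where "v = last_diff k"
    have "D \<noteq> {}"
    proof
      assume "D = {}"
      have "binary_digits k b = binary_digits (k + \<tau>) b" if "b < Suc r" for b
      proof -
        have "b \<in> \<pi> ` {..r}"
          using permutes_image[OF perm] that by simp
        then obtain \<alpha> where "\<alpha> \<le> r" "b = \<pi> \<alpha>"
          by auto
        then show ?thesis
          using \<open>D = {}\<close> by (auto simp: D_def)
      qed
      then have "k = k + \<tau>"
        using k by (intro binary_digits_eqI[of _ "Suc r"]) auto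
      then show False
        using \<open>\<tau> \<ge> 1\<close> by simp
    qed
    moreover have "finite D"
      by (simp add: D_def)
    ultimately have "v \<in> D" and v_max: "\<And>\<alpha>. \<alpha> \<in> D \<Longrightarrow> \<alpha> \<le> v"
      by (auto simp: v_def last_diff_def D_def[symmetric])
    \<comment> \<open>Agreement at \<open>\<pi> r\<close>, the defining property of
      \<open>S\<close>, guarantees that the path has a vertex after \<open>v\<close>.\<close>
    then have v: "v < r" and neq: "binary_digits k (\<pi> v) \<noteq> binary_digits (k + \<tau>) (\<pi> v)"
      using same by (auto simp: D_def order_le_less)
    have agree: "binary_digits k (\<pi> \<alpha>) = binary_digits (k + \<tau>) (\<pi> \<alpha>)" if "v < \<alpha>" "\<alpha> \<le> r" for \<alpha>
      using v_max[of \<alpha>] that by (auto simp: D_def)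
    define b where "b = \<pi> (Suc v)"
    have b: "b \<le> r" "binary_digits k b = binary_digits (k + \<tau>) b"
      using \<pi>_le[of "Suc v"] agree[of "Suc v"] v by (auto simp: b_def)
    have \<phi>k: "\<phi> k = flip_bit b k"
      by (simp add: \<phi>_def b_def v_def)
    have \<phi>\<tau>: "\<phi> k + \<tau> = flip_bit b (k + \<tau>)"
    proof -
      have "int (\<phi> k + \<tau>) = int (flip_bit b (k + \<tau>))"
        using b unfolding \<phi>k of_nat_add int_flip_bit by simp
      then show ?thesis
        by linarith
    qed
    \<comment> \<open>The common flip does not change where the two numbers differ, so
      \<open>\<phi>\<close> selects the same bit again and is an involution.\<close>
    have diff_iff: "binary_digits (\<phi> k) c \<noteq> binary_digits (\<phi> k + \<tau>) c
        \<longleftrightarrow> binary_digits k c \<noteq> binary_digits (k + \<tau>) c" for c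
      unfolding \<phi>\<tau> unfolding \<phi>k by (simp add: binary_digits_flip_bit)
    have "last_diff (\<phi> k) = v"
      unfolding v_def last_diff_def diff_iff ..
    then have "\<phi> (\<phi> k) = flip_bit b (flip_bit b k)"
      unfolding \<phi>_def[of "\<phi> k"] by (simp only: b_def[symmetric] \<phi>k)
    also have "\<dots> = k"
      by (rule bit_eqI) (auto simp: bit_flip_bit_iff)
    finally have inv: "\<phi> (\<phi> k) = k" .
    have "\<phi> k + \<tau> < 2 ^ Suc r"
      unfolding \<phi>\<tau> using k b by (intro flip_bit_less_power2) auto
    then have "\<phi> k \<in> S"
      using diff_iff[of "\<pi> r"] same by (auto simp: S_def)
    moreover have "t (\<phi> k) = - t k"
    proof -
      let ?P = "\<lambda>i. path_form r \<pi> (binary_digits i)"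
      let ?L = "\<lambda>i. linear_form r e f (binary_digits i)"
      have "odd ((?P (\<phi> k) - ?P (\<phi> k + \<tau>)) - (?P k - ?P (k + \<tau>)))"
        unfolding \<phi>\<tau> unfolding \<phi>k b_def
        using neq agree by (intro path_form_flip_bit[OF inj v]) auto
      then have P: "(-1 :: complex) powi (?P (\<phi> k) - ?P (\<phi> k + \<tau>)) = - ((-1) powi (?P k - ?P (k + \<tau>)))"
        by (auto simp: power_int_minus_left)
      have L: "?L (\<phi> k) - ?L (\<phi> k + \<tau>) = ?L k - ?L (k + \<tau>)"
        using linear_form_flip_bit[OF b(1), of e f k] linear_form_flip_bit[OF b(1), of e f "k + \<tau>"] b(2)
        unfolding \<phi>\<tau> unfolding \<phi>k by simp
      have E: "binary_digits (\<phi> k) (\<pi> r) - binary_digits (\<phi> k + \<tau>) (\<pi> r)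
          = binary_digits k (\<pi> r) - binary_digits (k + \<tau>) (\<pi> r)"
        using diff_iff[of "\<pi> r"] same by simp
      show ?thesis
        unfolding t_eq P L E by simp
    qed
    ultimately show ?thesis
      using inv by simp
  qed
  have "(\<Sum>k<2 ^ Suc r - \<tau>. t k) = sum t S"
    using outside by (intro sum.mono_neutral_right) (auto simp: S_def)
  also have "\<dots> = 0"
    by (rule sum_sign_reversing_involution[of _ \<phi>]) (use main in auto)
  finally show ?thesis
    by (simp only: t_def)
qed

section \<open>Concatenating a pair with its mate and adding end entries\<close>

text \<open>Positions are those of the untruncated sequence: an end entry at \<open>M - 1\<close>,
  blocks starting at \<open>M\<close> and \<open>2 * M\<close>, an end entry at
  \<open>3 * M\<close>. The map \<open>i \<mapsto> 4 * M - 1 - i\<close> exchanges the blocks, so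
  \<open>golay\<close> for the first block also settles the second.\<close>

lemma extended_mate_concatenation:
  fixes a b :: "nat \<Rightarrow> complex" and M \<tau> :: nat
  assumes K: "norm K = 1"
    and rev_a: "\<And>i. i < M \<Longrightarrow> a (3 * M - 1 - i) = - K * cnj (b (M + i))"
    and rev_b: "\<And>i. i < M \<Longrightarrow> b (3 * M - 1 - i) = K * cnj (a (M + i))"
    and golay: "(\<Sum>k<M - \<tau>. a (M + k) * cnj (a (M + k + \<tau>)) + b (M + k) * cnj (b (M + k + \<tau>))) = 0"
    and left: "b (M - 1) = - a (M - 1)" and right: "b (3 * M) = a (3 * M)"
    and corner: "a (M - 1) = - K * cnj (a (3 * M))"
    and \<tau>: "1 \<le> \<tau>" "\<tau> \<le> 2 * M"
    and cancel: "M < \<tau> \<Longrightarrow> a (3 * M - \<tau>) + b (3 * M - \<tau>) = 0"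
  shows "(\<Sum>k=M - 1..3 * M - \<tau>. a k * cnj (a (k + \<tau>)) + b k * cnj (b (k + \<tau>))) = 0"
proof -
  define t where "t k = a k * cnj (a (k + \<tau>)) + b k * cnj (b (k + \<tau>))" for k
  have "M \<ge> 1"
    using \<tau> by simp
  have KK: "K * cnj K = 1" "cnj K * K = 1"
    using K by (simp_all flip: complex_norm_square add: mult.commute)
  have KK': "K * (cnj K * z) = z" "cnj K * (K * z) = z" for z
    using KK by (simp_all flip: mult.assoc)
  have first_half: "a (4 * M - 1 - i) = - K * cnj (b i)" "b (4 * M - 1 - i) = K * cnj (a i)"
    if "M \<le> i" "i < 2 * M" for i
  proof -
    have "4 * M - 1 - i = 3 * M - 1 - (i - M)" "M + (i - M) = i" "i - M < M"
      using that by auto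
    then show "a (4 * M - 1 - i) = - K * cnj (b i)" "b (4 * M - 1 - i) = K * cnj (a i)"
      using rev_a[of "i - M"] rev_b[of "i - M"] by simp_all
  qed
  \<comment> \<open>Inverting \<open>first_half\<close> moves the minus sign from \<open>a\<close>
    to \<open>b\<close>. Hence reflecting a product within one block gives no sign, while a product
    across the blocks picks up exactly one.\<close>
  have second_half: "a (4 * M - 1 - i) = K * cnj (b i)" "b (4 * M - 1 - i) = - K * cnj (a i)"
    if "2 * M \<le> i" "i < 3 * M" for i
  proof -
    have "4 * M - 1 - (4 * M - 1 - i) = i" "M \<le> 4 * M - 1 - i" "4 * M - 1 - i < 2 * M"
      using that by auto
    then show "a (4 * M - 1 - i) = K * cnj (b i)" "b (4 * M - 1 - i) = - K * cnj (a i)"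
      using first_half[of "4 * M - 1 - i"] by (simp_all add: KK')
  qed
  have reflect: "4 * M - 1 - (k + \<tau>) + \<tau> = 4 * M - 1 - k" if "k + \<tau> < 3 * M" for k
    using that by simp

  \<comment> \<open>The reflection \<open>k \<mapsto> 4 * M - 1 - (k + \<tau>)\<close> swaps \<open>K1\<close> and \<open>K3\<close> preserving the terms,
    and negates the terms on \<open>K2\<close>.\<close>
  define K1 where "K1 = {k. M \<le> k \<and> k + \<tau> < 2 * M}"
  define K2 where "K2 = {k. M \<le> k \<and> k < 2 * M \<and> 2 * M \<le> k + \<tau> \<and> k + \<tau> < 3 * M}"
  define K3 where "K3 = {k. 2 * M \<le> k \<and> k + \<tau> < 3 * M}"
  have fin: "finite K1" "finite K2" "finite K3"
    by (rule finite_subset[of _ "{..3 * M}"]; force simp: K1_def K2_def K3_def)+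
  have "sum t K1 = (\<Sum>k<M - \<tau>. t (M + k))"
    by (rule sum.reindex_bij_witness[of _ "\<lambda>k. M + k" "\<lambda>k. k - M"]) (auto simp: K1_def)
  also have "\<dots> = 0"
    using golay by (simp add: t_def)
  finally have s1: "sum t K1 = 0" .
  have "sum t K3 = sum t K1"
  proof (rule sum.reindex_bij_witness[of _ "\<lambda>k. 4 * M - 1 - (k + \<tau>)" "\<lambda>k. 4 * M - 1 - (k + \<tau>)"])
    fix k assume "k \<in> K3"
    then have k: "2 * M \<le> k" "k + \<tau> < 3 * M"
      by (auto simp: K3_def)
    then show "t (4 * M - 1 - (k + \<tau>)) = t k"
      unfolding t_def reflect[OF k(2)]
      using second_half[of k] second_half[of "k + \<tau>"] by (simp add: KK' mult_ac)
  qed (auto simp: K1_def K3_def)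
  then have s3: "sum t K3 = 0"
    using s1 by simp
  have s2: "sum t K2 = 0"
  proof (rule sum_sign_reversing_involution[of _ "\<lambda>k. 4 * M - 1 - (k + \<tau>)"])
    fix k assume "k \<in> K2"
    then have k: "M \<le> k" "k < 2 * M" "2 * M \<le> k + \<tau>" "k + \<tau> < 3 * M"
      by (auto simp: K2_def)
    then show "t (4 * M - 1 - (k + \<tau>)) = - t k"
      unfolding t_def reflect[OF k(4)]
      using first_half[of k] second_half[of "k + \<tau>"] by (simp add: KK' mult_ac)
  qed (auto simp: K2_def)

  have ends: "t (M - 1) + t (3 * M - \<tau>) = 0"
  proof (cases "\<tau> \<le> M")
    \<comment> \<open>The left end meets the first block and the right end meets the second; the
      mate relation together with \<open>corner\<close> makes the two terms opposite.\<close>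
    case True
    have idx: "3 * M - \<tau> = 4 * M - 1 - (M - 1 + \<tau>)" "3 * M - \<tau> + \<tau> = 3 * M"
      using True \<tau> by auto
    have "a (3 * M - \<tau>) = - K * cnj (b (M - 1 + \<tau>))" "b (3 * M - \<tau>) = K * cnj (a (M - 1 + \<tau>))"
      unfolding idx(1) using True \<tau> by (intro first_half; simp)+
    then show ?thesis
      unfolding t_def idx(2) left right corner by (simp add: algebra_simps)
  next
    \<comment> \<open>Now the left end meets the second block and the right end meets the first.
      Both terms are multiples of \<open>a + b\<close> at \<open>3 * M - \<tau>\<close>, or of its
      conjugate, so each vanishes by \<open>cancel\<close>.\<close>
    case False
    have idx: "M - 1 + \<tau> = 4 * M - 1 - (3 * M - \<tau>)" "3 * M - \<tau> + \<tau> = 3 * M"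
      using False \<tau> by auto
    have "a (M - 1 + \<tau>) = - K * cnj (b (3 * M - \<tau>))" "b (M - 1 + \<tau>) = K * cnj (a (3 * M - \<tau>))"
      unfolding idx(1) using False \<tau> by (intro first_half; simp)+
    moreover have "b (3 * M - \<tau>) = - a (3 * M - \<tau>)"
      using cancel False by (simp add: add_eq_0_iff)
    ultimately show ?thesis
      unfolding t_def idx(2) left right by simp
  qed
  \<comment> \<open>The bound \<open>\<tau> \<le> 2 * M\<close> gives
    \<open>M - 1 < 3 * M - \<tau>\<close>, so the two end terms have distinct indices.\<close>
  have "{M - 1..3 * M - \<tau>} = {M - 1, 3 * M - \<tau>} \<union> (K1 \<union> (K2 \<union> K3))"
    using \<tau> by (auto simp: K1_def K2_def K3_def)
  moreover have "K2 \<inter> K3 = {}" "K1 \<inter> (K2 \<union> K3) = {}"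
    "{M - 1, 3 * M - \<tau>} \<inter> (K1 \<union> (K2 \<union> K3)) = {}"
    using \<tau> \<open>M \<ge> 1\<close> by (auto simp: K1_def K2_def K3_def)
  ultimately have "sum t {M - 1..3 * M - \<tau>}
      = sum t {M - 1, 3 * M - \<tau>} + (sum t K1 + (sum t K2 + sum t K3))"
    using fin by (simp only: sum.union_disjoint finite_Un finite.intros)
  also have "\<dots> = 0"
    using s1 s2 s3 ends \<tau> by auto
  finally show ?thesis
    by (simp add: t_def)
qed

section \<open>Powers of the root of unity and the generalized Boolean function\<close>

lemma norm_omega: "norm (omega q) = 1"
  by (simp add: omega_def)

lemma omega_powi_q: "q > 0 \<Longrightarrow> omega q powi int q = 1"
  by (simp add: omega_def flip: exp_of_nat_mult)

lemma omega_powi_half: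
  assumes "q > 0" "even q"
  shows "omega q powi int (q div 2) = -1"
proof -
  have "of_nat (q div 2) * (2 * of_real pi * \<i> / of_nat q) = (of_real pi * \<i> :: complex)"
    using assms by (auto simp: field_simps elim!: evenE)
  then show ?thesis
    by (simp add: omega_def flip: exp_of_nat_mult)
qed

lemma omega_powi_mod:
  assumes "q > 0"
  shows "omega q powi (t mod int q) = omega q powi t"
proof -
  have "omega q \<noteq> 0"
    by (simp add: omega_def)
  then have "omega q powi (int q * (t div int q) + t mod int q) = omega q powi (t mod int q)"
    using omega_powi_q[OF assms] by (subst power_int_add) (simp_all only: power_int_mult, simp_all)
  then show ?thesis
    by simp
qed

text \<open>For \<open>r \<ge> 1\<close> the subtraction \<open>m - 4 = r - 1\<close> is not
  truncated, so the sum runs over exactly the \<open>r\<close> edges of the path.\<close>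

lemma zeta_path_form: "m = r + 3 \<Longrightarrow> r \<ge> 1 \<Longrightarrow>
    zeta m \<pi> d x = (path_form r \<pi> x + d * x (\<pi> r)) mod 2"
  by (cases r) (simp_all add: zeta_def path_form_def atLeast0AtMost lessThan_Suc_atMost)

lemma eta_path_form: "m = r + 3 \<Longrightarrow> r \<ge> 1 \<Longrightarrow>
    eta m \<pi> d x = (path_form r \<pi> (\<lambda>i. 1 - x i) + (1 - d) * x (\<pi> r)) mod 2"
  by (cases r) (simp_all add: eta_def path_form_def atLeast0AtMost lessThan_Suc_atMost)

lemma path_form_cong:
  assumes "\<pi> permutes {..r}" "\<And>j. j \<le> r \<Longrightarrow> x j = y j"
  shows "path_form r \<pi> x = path_form r \<pi> y"
  unfolding path_form_def
proof (intro sum.cong refl)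
  fix \<alpha> assume "\<alpha> \<in> {..<r}"
  then have "\<pi> \<alpha> \<le> r" "\<pi> (Suc \<alpha>) \<le> r"
    using permutes_in_image[OF assms(1)] by auto
  then show "x (\<pi> \<alpha>) * x (\<pi> (Suc \<alpha>)) = y (\<pi> \<alpha>) * y (\<pi> (Suc \<alpha>))"
    using assms(2) by simp
qed

lemma linear_form_cong:
  "(\<And>j. j \<le> r \<Longrightarrow> x j = y j) \<Longrightarrow> linear_form r e f x = linear_form r e f y"
  unfolding linear_form_def by (intro sum.cong) auto

lemma linear_form_complement:
  "linear_form r e f (\<lambda>i. 1 - x i) = (\<Sum>i\<le>r. e i + f i) - linear_form r e f x"
  unfolding linear_form_def sum_subtractf[symmetric] by (intro sum.cong) (auto simp: algebra_simps)

text \<open>Since \<open>omega q powi int (q div 2)\<close> is -1, the bracket turns into a sign;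
  the reduction modulo \<open>q\<close> is invisible to powers of \<open>omega q\<close>.\<close>

lemma omega_powi_gbf:
  assumes "q > 0" "even q" "m = r + 3"
  shows "omega q powi gbf q m \<pi> e f d x =
    (-1) powi (x (r + 1) * (1 - x (r + 2)) * zeta m \<pi> d x + (1 - x (r + 1)) * x (r + 2) * eta m \<pi> d x
        + d * (1 - x (r + 1)) * (1 - x (r + 2)) + x (r + 1) * x (r + 2))
      * omega q powi linear_form r e f x"
proof -
  have "omega q \<noteq> 0"
    by (simp add: omega_def)
  have L: "(\<Sum>i = 0..r. e i * x i) + (\<Sum>i = 0..r. f i * (1 - x i)) = linear_form r e f x"
    by (simp add: linear_form_def sum.distrib atLeast0AtMost)
  have m: "m - 2 = r + 1" "m - 1 = r + 2" "m - 3 = r"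
    using assms by auto
  show ?thesis
    unfolding gbf_def omega_powi_mod[OF assms(1)] m add.assoc[of "int (q div 2) * _"] L
    using \<open>omega q \<noteq> 0\<close> omega_powi_half[OF assms(1,2)]
    by (subst power_int_add) (simp_all only: power_int_mult, simp_all)
qed

section \<open>The four blocks of the sequences\<close>

locale zcp_construction =
  fixes q m r :: nat and \<pi> :: "nat \<Rightarrow> nat" and e f :: "nat \<Rightarrow> int"
  assumes q: "q > 0" "even q" and m: "m = r + 3" and r: "r \<ge> 1" and perm: "\<pi> permutes {..r}"
begin

abbreviation (input) "u d i \<equiv> omega q powi gbf q m \<pi> e f d (binary_digits i)"
abbreviation (input) "M \<equiv> (2 :: nat) ^ Suc r"
abbreviation (input) "L i \<equiv> linear_form r e f (binary_digits i)"

text \<open>The two top variables number the blocks of length \<open>M\<close>: block 1 carries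
  \<open>zeta\<close> and block 2 carries \<open>eta\<close>, while only the last entry of block 0
  and the first of block 3 survive truncation.\<close>

lemma digits_top: "k < M \<Longrightarrow> binary_digits (M * t + k) (r + 1) = binary_digits t 0"
    "k < M \<Longrightarrow> binary_digits (M * t + k) (r + 2) = binary_digits t 1"
  using binary_digits_block[of k "Suc r" t "r + 1"] binary_digits_block[of k "Suc r" t "r + 2"]
  by simp_all

lemma digits_low: "k < M \<Longrightarrow> j \<le> r \<Longrightarrow> binary_digits (M * t + k) j = binary_digits k j"
  using binary_digits_block[of k "Suc r" t j] by simp

lemma linear_form_block: "k < M \<Longrightarrow> L (M * t + k) = L k"
  by (intro linear_form_cong digits_low)

lemma \<pi>_r: "\<pi> r \<le> r"
  using permutes_in_image[OF perm, of r] by simp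

lemma two_power_\<pi>_le: "2 ^ \<pi> r \<le> M"
  using \<pi>_r by (intro power_increasing) auto

lemma u_left: "u d (M - 1) = (-1) powi d * omega q powi L (M - 1)"
  using digits_top[of "M - 1" 0]
  unfolding omega_powi_gbf[OF q m] by (simp add: binary_digits_def)

lemma u_right: "u d (3 * M) = - (omega q powi L 0)"
  using digits_top[of 0 3] linear_form_block[of 0 3]
  unfolding omega_powi_gbf[OF q m] by (simp add: binary_digits_def mult.commute)

lemma u_zeta:
  assumes "k < M"
  shows "u d (M + k) = golay_seq (omega q) r \<pi> e f d k"
proof -
  have "path_form r \<pi> (binary_digits (M + k)) = path_form r \<pi> (binary_digits k)"
    using digits_low[OF assms, of _ 1] by (intro path_form_cong[OF perm]) simp
  moreover have "binary_digits (M + k) (\<pi> r) = binary_digits k (\<pi> r)"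
    using digits_low[OF assms \<pi>_r, of 1] by simp
  ultimately show ?thesis
    using digits_top[OF assms, of 1] linear_form_block[OF assms, of 1]
    unfolding omega_powi_gbf[OF q m] zeta_path_form[OF m r] golay_seq_def
    by (simp add: binary_digits_def minus_one_powi_cong)
qed

text \<open>Counting from the end of block 2 complements the digits, and \<open>eta\<close> is
  written in complemented variables, so the path form of \<open>k\<close> returns. The end term has
  coefficient \<open>1 - d\<close>, which exchanges the members of the pair; the linear form becomes
  a constant minus itself, hence the conjugate.\<close>

lemma u_eta:
  assumes "k < M"
  shows "u d (3 * M - 1 - k)
    = (-1) powi (1 - d) * omega q powi (\<Sum>i\<le>r. e i + f i) * cnj (golay_seq (omega q) r \<pi> e f (1 - d) k)"
proof -
  let ?k = "M - 1 - k"
  let ?x = "binary_digits k" and ?y = "binary_digits (2 * M + ?k)"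
  have "?k < M"
    using assms by simp
  have y: "?y j = 1 - ?x j" if "j \<le> r" for j
    using digits_low[OF \<open>?k < M\<close> that, of 2] binary_digits_complement[OF assms, of j] that
    by (simp add: mult.commute)
  have path: "path_form r \<pi> (\<lambda>i. 1 - ?y i) = path_form r \<pi> ?x"
    using y by (intro path_form_cong[OF perm]) simp
  have lin: "linear_form r e f ?y = (\<Sum>i\<le>r. e i + f i) - L k"
    unfolding linear_form_complement[symmetric] using y by (intro linear_form_cong)
  have idx: "3 * M - 1 - k = 2 * M + ?k"
    using assms by simp
  have top: "?y (r + 1) = 0" "?y (r + 2) = 1"
    using digits_top[OF \<open>?k < M\<close>, of 2] by (simp_all add: binary_digits_def mult.commute)
  have "omega q \<noteq> 0"
    by (simp add: omega_def)
  have "u d (3 * M - 1 - k) = (-1) powi ((path_form r \<pi> ?x + (1 - d) * (1 - ?x (\<pi> r))) mod 2)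
      * omega q powi ((\<Sum>i\<le>r. e i + f i) - L k)"
    unfolding idx omega_powi_gbf[OF q m] eta_path_form[OF m r] path lin top y[OF \<pi>_r] by simp
  \<comment> \<open>The exponents differ by twice the path form; the negated version matches the
    conjugated sequence.\<close>
  also have "(-1 :: complex) powi ((path_form r \<pi> ?x + (1 - d) * (1 - ?x (\<pi> r))) mod 2)
      = (-1) powi ((1 - d) - (path_form r \<pi> ?x + (1 - d) * ?x (\<pi> r)))"
    by (intro minus_one_powi_cong) auto
  finally show ?thesis
    unfolding golay_seq_def complex_cnj_mult cnj_powi_unit[OF norm_omega] cnj_minus_one_powi
      powi_diff[of "-1" "1 - d", OF minus_one_nonzero] powi_diff[OF \<open>omega q \<noteq> 0\<close>, of "sum _ _"]
    by (simp only: mult_ac)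
qed

lemma u_cancel:
  assumes "M < \<tau>" "\<tau> \<le> M + 2 ^ \<pi> r"
  shows "u 0 (3 * M - \<tau>) + u 1 (3 * M - \<tau>) = 0"
proof -
  \<comment> \<open>\<open>s\<close> is the distance to the last position of block 1. As
    \<open>s < 2 ^ \<pi> r\<close>, its digit at \<open>\<pi> r\<close> is 0 and the complementary
    position has digit 1, where the pair has opposite entries. This fixes the width.\<close>
  define s where "s = \<tau> - M - 1"
  have s: "s < 2 ^ \<pi> r"
    using assms by (simp add: s_def)
  have "s < M"
    using s two_power_\<pi>_le by linarith
  have "3 * M - \<tau> = M + (M - 1 - s)"
    using assms \<open>s < M\<close> by (simp add: s_def)
  moreover have "binary_digits (M - 1 - s) (\<pi> r) = 1"
    using binary_digits_complement[OF \<open>s < M\<close>, of "\<pi> r"] \<pi>_r s by (simp add: binary_digits_def)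
  ultimately show ?thesis
    using u_zeta[of "M - 1 - s"] by (simp add: golay_seq_def power_int_add)
qed

lemma u_autocorrelation:
  assumes "1 \<le> \<tau>" "\<tau> \<le> M + 2 ^ \<pi> r"
  shows "(\<Sum>k=M - 1..3 * M - \<tau>. u 0 k * cnj (u 0 (k + \<tau>)) + u 1 k * cnj (u 1 (k + \<tau>))) = 0"
proof (rule extended_mate_concatenation[where K = "omega q powi (\<Sum>i\<le>r. e i + f i)"])
  show "\<tau> \<le> 2 * M"
    using assms two_power_\<pi>_le by linarith
  show "norm (omega q powi (\<Sum>i\<le>r. e i + f i)) = 1"
    by (simp add: norm_power_int norm_omega)
  show "u 0 (3 * M - 1 - i) = - (omega q powi (\<Sum>i\<le>r. e i + f i)) * cnj (u 1 (M + i))"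
    "u 1 (3 * M - 1 - i) = omega q powi (\<Sum>i\<le>r. e i + f i) * cnj (u 0 (M + i))" if "i < M" for i
    unfolding u_eta[OF that] u_zeta[OF that] by simp_all
  have "(\<Sum>k<M - \<tau>. u 0 (M + k) * cnj (u 0 (M + k + \<tau>)) + u 1 (M + k) * cnj (u 1 (M + k + \<tau>)))
    = (\<Sum>k<M - \<tau>. golay_seq (omega q) r \<pi> e f 0 k * cnj (golay_seq (omega q) r \<pi> e f 0 (k + \<tau>))
        + golay_seq (omega q) r \<pi> e f 1 k * cnj (golay_seq (omega q) r \<pi> e f 1 (k + \<tau>)))"
    by (intro sum.cong refl) (simp add: u_zeta add.assoc del: power_Suc complex_cnj_power_int)
  also have "\<dots> = 0"
    using golay_pair[OF norm_omega perm assms(1)] .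
  finally show "(\<Sum>k<M - \<tau>. u 0 (M + k) * cnj (u 0 (M + k + \<tau>)) + u 1 (M + k) * cnj (u 1 (M + k + \<tau>))) = 0" .
  show "u 1 (M - 1) = - u 0 (M - 1)"
    unfolding u_left by simp
  show "u 1 (3 * M) = u 0 (3 * M)"
    unfolding u_right ..
  \<comment> \<open>The low digits are all 1 at the left end and all 0 at the right end, so
    complementing the linear form links the ends by the same constant as the blocks.\<close>
  have "L (M - 1) = linear_form r e f (\<lambda>i. 1 - binary_digits 0 i)"
    using binary_digits_complement[of 0 "Suc r"] by (intro linear_form_cong) simp
  moreover have "omega q \<noteq> 0"
    by (simp add: omega_def)
  ultimately show "u 0 (M - 1) = - (omega q powi (\<Sum>i\<le>r. e i + f i)) * cnj (u 0 (3 * M))"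
    unfolding u_left u_right complex_cnj_minus cnj_powi_unit[OF norm_omega] linear_form_complement
    by (simp add: power_int_diff power_int_minus divide_inverse)
  show "u 0 (3 * M - \<tau>) + u 1 (3 * M - \<tau>) = 0" if "M < \<tau>"
    using u_cancel[OF that assms(2)] .
qed (use assms in simp)

end

section \<open>Truncation and the final width\<close>

lemma length_Psi_trunc: "2 * L \<le> 2 ^ m \<Longrightarrow> length (Psi_trunc q m L g) = 2 ^ m - 2 * L"
  by (simp add: Psi_trunc_def Psi_def)

lemma nth_Psi_trunc:
  "k < 2 ^ m - 2 * L \<Longrightarrow> Psi_trunc q m L g ! k = omega q powi g (binary_digits (L + k))"
  by (simp add: Psi_trunc_def Psi_def less_diff_conv add.commute)

text \<open>Summing over the original positions keeps the block structure visible; the last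
  surviving position is \<open>2 ^ m - L - 1\<close>.\<close>

lemma autocorrelation_Psi_trunc:
  assumes "2 * L \<le> 2 ^ m" "\<tau> < 2 ^ m - 2 * L"
  shows "autocorrelation (Psi_trunc q m L g) \<tau> = (\<Sum>k=L..2 ^ m - L - 1 - \<tau>.
    omega q powi g (binary_digits k) * cnj (omega q powi g (binary_digits (k + \<tau>))))"
proof -
  have "autocorrelation (Psi_trunc q m L g) \<tau> = (\<Sum>k=0..2 ^ m - 2 * L - 1 - \<tau>.
      Psi_trunc q m L g ! k * cnj (Psi_trunc q m L g ! (k + \<tau>)))"
    using assms by (simp add: autocorrelation_def length_Psi_trunc)
  also have "\<dots> = (\<Sum>k=L..2 ^ m - L - 1 - \<tau>.
    omega q powi g (binary_digits k) * cnj (omega q powi g (binary_digits (k + \<tau>))))"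
    using assms
    by (intro sum.reindex_bij_witness[of _ "\<lambda>k. k - L" "\<lambda>k. k + L"])
      (auto simp: nth_Psi_trunc add_ac simp del: complex_cnj_power_int)
  finally show ?thesis .
qed

theorem theorem1:
  fixes q m :: nat and \<pi> :: "nat \<Rightarrow> nat" and e f :: "nat \<Rightarrow> int" and a b :: "complex list"
  assumes "q \<ge> 2" and "even q" and "m \<ge> 4"
    and "\<pi> permutes {0..m - 3}"
    and "\<And>i. i \<in> {0..m - 3} \<Longrightarrow> e i \<in> {0..<int q}"
    and "\<And>i. i \<in> {0..m - 3} \<Longrightarrow> f i \<in> {0..<int q}"
    and "a = Psi_trunc q m (2 ^ (m - 2) - 1) (gbf q m \<pi> e f 0)"
    and "b = Psi_trunc q m (2 ^ (m - 2) - 1) (gbf q m \<pi> e f 1)"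
  shows "Z_complementary_pair (2 ^ m - 2 * (2 ^ (m - 2) - 1)) (2 ^ (m - 2) + 2 ^ \<pi> (m - 3) + 1) a b
    \<and> (2 :: nat) ^ m - 2 * (2 ^ (m - 2) - 1) = 2 ^ (m - 1) + 2
    \<and> even ((2 :: nat) ^ (m - 1) + 2)"
proof -
  define r where "r = m - 3"
  define M :: nat where "M = 2 ^ Suc r"
  have mr: "m = r + 3" "m - 3 = r" "m - 2 = Suc r" "m - 1 = Suc (Suc r)" and r: "r \<ge> 1"
    using assms(3) by (auto simp: r_def)
  have perm: "\<pi> permutes {..r}"
    using assms(4) by (simp add: r_def atLeast0AtMost)
  have "M \<ge> 1"
    by (simp add: M_def)
  have pow: "(2 :: nat) ^ m = 4 * M" "(2 :: nat) ^ (m - 1) = 2 * M" "(2 :: nat) ^ (m - 2) = M"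
    using mr(3,4) by (simp_all add: M_def mr(1) power_add)
  interpret zcp_construction q m r \<pi> e f
    using assms(1,2) mr(1) r perm by unfold_locales auto
  have le: "2 ^ \<pi> r \<le> M"
    unfolding M_def by (rule two_power_\<pi>_le)
  have "autocorrelation a \<tau> + autocorrelation b \<tau> = 0" if "1 \<le> \<tau>" "\<tau> \<le> M + 2 ^ \<pi> r" for \<tau>
  proof -
    \<comment> \<open>The shift is at most \<open>2 * M\<close>, below the length
      \<open>2 * M + 2\<close>, so the default value 0 of \<open>autocorrelation\<close> never
      applies.\<close>
    have "2 * (M - 1) \<le> 2 ^ m" "\<tau> < 2 ^ m - 2 * (M - 1)"
      using that le \<open>M \<ge> 1\<close> by (simp_all add: pow)
    moreover have "2 ^ m - (M - 1) - 1 - \<tau> = 3 * M - \<tau>"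
      using \<open>M \<ge> 1\<close> by (simp add: pow)
    ultimately show ?thesis
      using u_autocorrelation[OF that[unfolded M_def]]
      unfolding assms(7,8) pow(3)
      by (simp add: autocorrelation_Psi_trunc M_def[symmetric] sum.distrib del: power_Suc)
  qed
  moreover have "length a = 2 ^ m - 2 * (M - 1)" "length b = 2 ^ m - 2 * (M - 1)"
    using \<open>M \<ge> 1\<close> unfolding assms(7,8) pow(3) by (simp_all add: length_Psi_trunc pow(1))
  ultimately show ?thesis
    using \<open>M \<ge> 1\<close> unfolding Z_complementary_pair_def mr(2) pow(2,3) by (auto simp: pow(1))
qed

end
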